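(* Let $\eta>0$, and let $M$, $K$, $m$ be the mass matrix, stiffness matrix and mean-value vector of the piecewise linear finite element space described in the context, with $\bar K=K+mm^T$. Let $$\mathcal{A}=\begin{pmatrix}\bar K & M\\ M & -\eta\bar K\end{pmatrix},\qquad \mathcal{B}_{\mathrm{btdsc}}=\begin{pmatrix}\bar K & 0\\ M & -S_{\mathrm{pre}}\end{pmatrix},\qquad S_{\mathrm{pre}}=(M+\sqrt\eta\,\bar K)\,\bar K^{-1}\,(M+\sqrt\eta\,\bar K).$$ Then every eigenvalue satisfies $$\lambda(\mathcal{B}_{\mathrm{btdsc}}^{-1}\mathcal{A})\in[1/2,1).$$
   Context: Let $\Omega=(0,1)\times(0,1)$, let $\mathcal{T}_h$ be a triangulation of $\Omega$ with node set $\mathcal{N}_h$, $n=|\mathcal{N}_h|$, and let $(\lambda_p)_{p\in\mathcal{N}_h}$ be the nodal basis of the space of continuous functions on $\bar\Omega$ that are linear on each triangle (no boundary conditions imposed). The mass matrix is $M=(\int_\Omega \lambda_p\lambda_q\,dx)_{p,q}$, the stiffness matrix is $K=(\int_\Omega \nabla\lambda_p\cdot\nabla\lambda_q\,dx)_{p,q}$, and $m=(\int_\Omega\lambda_p\,dx)_p\in\mathbb{R}^n$. The parameter is $\eta=\epsilon\tau>0$, with $\epsilon>0$ the interface parameter and $\tau>0$ the time step.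
   Formalization: As stated the claim fails: A(v,0)=B(v,0) for all v, so 1 is always an eigenvalue. Proved instead: every eigenvalue lies in [1/2,1) or equals 1, and 1 has algebraic multiplicity exactly n, so the other n eigenvalues lie in [1/2,1). *)

theory Defs
  imports
    "HOL-Analysis.Analysis"
    "Jordan_Normal_Form.Char_Poly"
    "Jordan_Normal_Form.Gauss_Jordan_Elimination"
begin

section \<open>Piecewise linear finite elements on the unit square\<close>

type_synonym point = "real \<times> real"

definition Omega :: "point set" where
  "Omega = {0<..<1} \<times> {0<..<1}"

text \<open>The constant \<^const>\<open>triangulation\<close> of HOL-Analysis supplies finiteness and conformity: any two
  cells meet in a common (possibly empty) face. A 2-simplex is a nondegenerate closed triangle.\<close>

definition triangulates_Omega :: "point set set \<Rightarrow> bool" where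
  "triangulates_Omega \<T> \<longleftrightarrow>
     triangulation \<T> \<and> (\<forall>T\<in>\<T>. 2 simplex T) \<and> \<Union>\<T> = closure Omega"

definition nodes :: "point set set \<Rightarrow> point set" where
  "nodes \<T> = {p. \<exists>T\<in>\<T>. p extreme_point_of T}"

text \<open>Elements of the space are total functions on the plane, constrained only on the closed square.
  ``Linear'' on a triangle means affine.\<close>

definition fe_space :: "point set set \<Rightarrow> (point \<Rightarrow> real) set" where
  "fe_space \<T> = {v. continuous_on (closure Omega) v \<and>
                     (\<forall>T\<in>\<T>. \<exists>g c. \<forall>x\<in>T. v x = inner g x + c)}"

definition is_nodal_basis :: "point set set \<Rightarrow> (point \<Rightarrow> point \<Rightarrow> real) \<Rightarrow> bool" where
  "is_nodal_basis \<T> \<phi> \<longleftrightarrow>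
     (\<forall>p\<in>nodes \<T>. \<phi> p \<in> fe_space \<T> \<and> (\<forall>q\<in>nodes \<T>. \<phi> p q = (if p = q then 1 else 0)))"

text \<open>The classical gradient. For finite element functions it exists off the edges of the
  triangulation, hence almost everywhere in the square, where it is the weak gradient.\<close>

definition grad :: "(point \<Rightarrow> real) \<Rightarrow> point \<Rightarrow> point" where
  "grad f x = (THE D. GDERIV f x :> D)"

text \<open>The parameter \<open>nd\<close> enumerates the nodes as \<open>nd 0, \<dots>, nd (n - 1)\<close>; \<open>\<phi> p\<close> is the basis
  function of the node \<open>p\<close>.\<close>

definition mass_mat :: "nat \<Rightarrow> (nat \<Rightarrow> point) \<Rightarrow> (point \<Rightarrow> point \<Rightarrow> real) \<Rightarrow> real mat" where
  "mass_mat n nd \<phi> = mat n n (\<lambda>(i, j). LINT x:Omega|lebesgue. \<phi> (nd i) x * \<phi> (nd j) x)"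

definition stiffness_mat :: "nat \<Rightarrow> (nat \<Rightarrow> point) \<Rightarrow> (point \<Rightarrow> point \<Rightarrow> real) \<Rightarrow> real mat" where
  "stiffness_mat n nd \<phi> =
     mat n n (\<lambda>(i, j). LINT x:Omega|lebesgue. inner (grad (\<phi> (nd i)) x) (grad (\<phi> (nd j)) x))"

definition mean_vec :: "nat \<Rightarrow> (nat \<Rightarrow> point) \<Rightarrow> (point \<Rightarrow> point \<Rightarrow> real) \<Rightarrow> real Matrix.vec" where
  "mean_vec n nd \<phi> = Matrix.vec n (\<lambda>i. LINT x:Omega|lebesgue. \<phi> (nd i) x)"

definition Kbar_mat :: "nat \<Rightarrow> (nat \<Rightarrow> point) \<Rightarrow> (point \<Rightarrow> point \<Rightarrow> real) \<Rightarrow> real mat" where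
  "Kbar_mat n nd \<phi> = stiffness_mat n nd \<phi> +
     mat_of_cols n [mean_vec n nd \<phi>] * transpose_mat (mat_of_cols n [mean_vec n nd \<phi>])"

section \<open>The saddle point matrix and the block triangular preconditioner\<close>

text \<open>Meaningful for invertible matrices only.\<close>

definition mat_inv :: "'a :: field mat \<Rightarrow> 'a mat" where
  "mat_inv A = the (mat_inverse A)"

definition A_mat :: "real \<Rightarrow> real mat \<Rightarrow> real mat \<Rightarrow> real mat" where
  "A_mat \<eta> Kb M = four_block_mat Kb M M (- (\<eta> \<cdot>\<^sub>m Kb))"

definition S_pre :: "real \<Rightarrow> real mat \<Rightarrow> real mat \<Rightarrow> real mat" where
  "S_pre \<eta> Kb M = (M + sqrt \<eta> \<cdot>\<^sub>m Kb) * mat_inv Kb * (M + sqrt \<eta> \<cdot>\<^sub>m Kb)"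

definition B_btdsc :: "real \<Rightarrow> real mat \<Rightarrow> real mat \<Rightarrow> real mat" where
  "B_btdsc \<eta> Kb M = four_block_mat Kb (0\<^sub>m (dim_row Kb) (dim_col Kb)) M (- S_pre \<eta> Kb M)"

text \<open>Regarded as a complex matrix, since it is not symmetric and reality of its spectrum is part of
  the claim. Because \<open>A (v, 0) = B (v, 0)\<close> for all \<open>v\<close>, the number 1 is always an
  eigenvalue; the half-open interval \<open>[1/2, 1)\<close> can only hold the \<open>n\<close> eigenvalues (counted with
  algebraic multiplicity) that remain once these \<open>n\<close> trivial unit eigenvalues are split off.\<close>

definition preconditioned_mat :: "real \<Rightarrow> real mat \<Rightarrow> real mat \<Rightarrow> complex mat" where
  "preconditioned_mat \<eta> Kb M =
     map_mat complex_of_real (mat_inv (B_btdsc \<eta> Kb M) * A_mat \<eta> Kb M)"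

end

theory Submission
  imports Defs
begin

text \<open>Write \<open>K\<close> for the matrix \<open>Kb\<close>, and put
  \<open>T = M K\<inverse> M + \<eta> K\<close> and \<open>S = (M + sqrt \<eta> K) K\<inverse> (M + sqrt \<eta> K)\<close>. Block elimination gives
  \<open>B\<inverse> A = (1, K\<inverse> M; 0, S\<inverse> T)\<close>, so the characteristic polynomial is \<open>(x - 1)\<^sup>n\<close> times that
  of \<open>S\<inverse> T\<close>. An eigenvalue \<open>\<mu>\<close> of \<open>S\<inverse> T\<close> satisfies \<open>T w = \<mu> S w\<close> with \<open>S\<close> and \<open>T\<close>
  symmetric, so it is real and bounded by the extreme values of the Rayleigh quotient
  (\<open>generalized_eigenvalue_rayleigh\<close>). Expanding the product defining \<open>S\<close> gives

  \<open>S - T = 2 sqrt \<eta> M\<close> and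
  \<open>2 T - S = (M - sqrt \<eta> K) K\<inverse> (M - sqrt \<eta> K)\<close>.

  The first matrix is positive definite and the second positive semidefinite, which is
  \<open>1/2 \<le> \<mu> < 1\<close>. In particular 1 is not an eigenvalue of \<open>S\<inverse> T\<close>, so its multiplicity is
  exactly \<open>n\<close> (\<open>btdsc_spectrum\<close>).

  It remains to see that \<open>M\<close> and \<open>K\<close> are positive definite. The form of \<open>M\<close> is the squared
  \<open>L\<^sup>2\<close> norm of a continuous function determined by its nodal values (\<open>mass_spd\<close>). The form of
  \<open>K\<close> is the Dirichlet energy plus the squared mean: vanishing energy makes the function constant,
  and the mean detects constants (\<open>Kbar_spd\<close>).\<close>

unbundle no vec_syntax and no inner_syntax

section \<open>Quadratic forms and positive definite matrices\<close>

definition quad :: "real mat \<Rightarrow> real Matrix.vec \<Rightarrow> real" where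
  "quad A x = x \<bullet> (A *\<^sub>v x)"

definition spd :: "nat \<Rightarrow> real mat \<Rightarrow> bool" where
  "spd n A \<longleftrightarrow> A \<in> carrier_mat n n \<and> A\<^sup>T = A \<and>
     (\<forall>x\<in>carrier_vec n. x \<noteq> 0\<^sub>v n \<longrightarrow> quad A x > 0)"

lemma quad_sum:
  assumes "A \<in> carrier_mat n n" "x \<in> carrier_vec n"
  shows "quad A x = (\<Sum>i<n. \<Sum>j<n. A $$ (i, j) * (x $ i * x $ j))"
  using assms unfolding quad_def scalar_prod_def
  by (auto simp: scalar_prod_def sum_distrib_left lessThan_atLeast0 mult_ac intro!: sum.cong)

lemma quad_add:
  assumes "A \<in> carrier_mat n n" "B \<in> carrier_mat n n" "x \<in> carrier_vec n"
  shows "quad (A + B) x = quad A x + quad B x"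
  using assms unfolding quad_def
  by (simp add: add_mult_distrib_mat_vec[of _ n n] scalar_prod_add_distrib[of _ n])

lemma quad_smult:
  assumes "A \<in> carrier_mat n n" "x \<in> carrier_vec n"
  shows "quad (c \<cdot>\<^sub>m A) x = c * quad A x"
  using assms by (simp add: quad_sum[of _ n] sum_distrib_left mult_ac)

lemma mult_mat_vec_zero: "A \<in> carrier_mat n n \<Longrightarrow> A *\<^sub>v 0\<^sub>v n = (0\<^sub>v n :: real Matrix.vec)"
  by (intro eq_vecI) auto

lemma transpose_smult_mat: "(c \<cdot>\<^sub>m A)\<^sup>T = c \<cdot>\<^sub>m A\<^sup>T"
  by (intro eq_matI) auto

lemma quad_zero_vec: "A \<in> carrier_mat n n \<Longrightarrow> quad A (0\<^sub>v n) = 0"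
  by (simp add: quad_sum[of _ n])

lemma spd_nonneg: "spd n A \<Longrightarrow> x \<in> carrier_vec n \<Longrightarrow> quad A x \<ge> 0"
  unfolding spd_def by (metis quad_zero_vec less_eq_real_def)

text \<open>Moving the symmetric outer factors into the argument is what makes products like
  \<open>M K\<inverse> M\<close> visibly positive semidefinite.\<close>

lemma quad_sandwich:
  assumes A: "A \<in> carrier_mat n n" "A\<^sup>T = A" and B: "B \<in> carrier_mat n n"
    and x: "x \<in> carrier_vec n"
  shows "quad (A * B * A) x = quad B (A *\<^sub>v x)"
proof -
  have "x \<bullet> (A *\<^sub>v (B *\<^sub>v (A *\<^sub>v x))) = (A *\<^sub>v x) \<bullet> (B *\<^sub>v (A *\<^sub>v x))"
    using transpose_vec_mult_scalar[of A n n "B *\<^sub>v (A *\<^sub>v x)" x] A B x by simp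
  then show ?thesis
    unfolding quad_def using A B x by (simp add: assoc_mult_mat_vec[of _ n n _ n])
qed

lemma mat_inv_inverse:
  fixes A :: "'a :: field mat"
  assumes A: "A \<in> carrier_mat n n" and "det A \<noteq> 0"
  shows "mat_inv A \<in> carrier_mat n n" "A * mat_inv A = 1\<^sub>m n" "mat_inv A * A = 1\<^sub>m n"
proof -
  obtain B where "mat_inverse A = Some B"
    using mat_inverse(1)[OF A] det_non_zero_imp_unit[OF assms] by fastforce
  then show "mat_inv A \<in> carrier_mat n n" "A * mat_inv A = 1\<^sub>m n" "mat_inv A * A = 1\<^sub>m n"
    using mat_inverse(2)[OF A] unfolding mat_inv_def by auto
qed

lemma invertible_mat_det:
  fixes A :: "'a :: field mat"
  assumes "A \<in> carrier_mat n n" "det A \<noteq> 0"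
  shows "invertible_mat A"
  using mat_inv_inverse[OF assms] assms(1)
  unfolding invertible_mat_def inverts_mat_def square_mat.simps by (metis carrier_matD)

lemma spd_det:
  assumes "spd n A"
  shows "det A \<noteq> 0"
proof
  assume "det A = 0"
  then obtain v where v: "v \<in> carrier_vec n" "v \<noteq> 0\<^sub>v n" "A *\<^sub>v v = 0\<^sub>v n"
    using assms det_0_iff_vec_prod_zero[of A n] unfolding spd_def by auto
  then have "quad A v = 0" by (simp add: quad_def)
  then show False using v assms unfolding spd_def by force
qed

text \<open>Positivity of the inverse: its quadratic form at \<open>x\<close> is that of \<open>A\<close> at the solution of
  \<open>A y = x\<close>.\<close>

lemma spd_mat_inv:
  assumes "spd n A"
  shows "mat_inv A \<in> carrier_mat n n" "A * mat_inv A = 1\<^sub>m n" "mat_inv A * A = 1\<^sub>m n"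
    "spd n (mat_inv A)"
proof -
  have A: "A \<in> carrier_mat n n" "A\<^sup>T = A" using assms by (auto simp: spd_def)
  let ?B = "mat_inv A"
  show B: "?B \<in> carrier_mat n n" and AB: "A * ?B = 1\<^sub>m n" and BA: "?B * A = 1\<^sub>m n"
    using mat_inv_inverse[OF A(1) spd_det[OF assms]] by auto
  have "?B\<^sup>T * A = 1\<^sub>m n"
    using arg_cong[OF AB, of transpose_mat] A B by (simp add: transpose_mult[of _ n n])
  then have "?B\<^sup>T = ?B"
    using assoc_mult_mat[of "?B\<^sup>T" n n A n ?B n] A B AB by simp
  moreover have "quad ?B x > 0" if x: "x \<in> carrier_vec n" "x \<noteq> 0\<^sub>v n" for x
  proof -
    let ?y = "?B *\<^sub>v x"
    have Ay: "A *\<^sub>v ?y = x"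
      using assoc_mult_mat_vec[of A n n ?B n x] A B AB x by simp
    have "?y \<noteq> 0\<^sub>v n"
      using Ay x mult_mat_vec_zero[OF A(1)] by metis
    then have "quad A ?y > 0" using assms x B by (auto simp: spd_def)
    also have "quad A ?y = quad (A * ?B * A) ?y"
      using A AB by simp
    also have "\<dots> = quad ?B x"
      using quad_sandwich[OF A B, of ?y] B x Ay by simp
    finally show ?thesis .
  qed
  ultimately show "spd n ?B" using B by (auto simp: spd_def)
qed

section \<open>Eigenvalues of symmetric definite pencils\<close>

text \<open>The cross terms \<open>Re w\<^sub>i Im w\<^sub>j - Im w\<^sub>i Re w\<^sub>j\<close> are antisymmetric in \<open>i, j\<close>, so a symmetric matrix
  annihilates them. This reduces complex eigenvectors to two real quadratic forms.\<close>

lemma hermitian_form_real: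
  assumes A: "A \<in> carrier_mat n n" "A\<^sup>T = A" and w: "w \<in> carrier_vec n"
  shows "(\<Sum>i<n. cnj (w $ i) * (map_mat complex_of_real A *\<^sub>v w) $ i)
    = of_real (quad A (map_vec Re w) + quad A (map_vec Im w))"
proof -
  have sym: "A $$ (j, i) = A $$ (i, j)" if "i < n" "j < n" for i j
    using A that by (metis carrier_matD index_transpose_mat(1))
  have "(\<Sum>i<n. \<Sum>j<n. A $$ (i, j) * (Im (w $ i) * Re (w $ j)))
      = (\<Sum>i<n. \<Sum>j<n. A $$ (i, j) * (Re (w $ i) * Im (w $ j)))"
    by (subst sum.swap) (auto simp: sym mult_ac intro!: sum.cong)
  moreover have "(\<Sum>i<n. cnj (w $ i) * (map_mat complex_of_real A *\<^sub>v w) $ i)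
      = (\<Sum>i<n. \<Sum>j<n. A $$ (i, j) * (cnj (w $ i) * w $ j))"
    using A w by (auto simp: scalar_prod_def sum_distrib_left lessThan_atLeast0 mult_ac intro!: sum.cong)
  ultimately show ?thesis
    using A w
    by (simp add: complex_eq_iff quad_sum[of _ n] sum.distrib sum_subtractf algebra_simps)
qed

text \<open>Multiplying \<open>T w = \<mu> S w\<close> by the conjugate of \<open>w\<close> exhibits \<open>\<mu>\<close> as a quotient of sums of real quadratic forms
  at the real and imaginary parts of \<open>w\<close>. Hence \<open>\<mu>\<close> is real, and pointwise bounds on the real
  Rayleigh quotient carry over to it.\<close>

lemma generalized_eigenvalue_rayleigh:
  assumes T: "T \<in> carrier_mat n n" "T\<^sup>T = T" and S: "S \<in> carrier_mat n n" "S\<^sup>T = S"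
    and bounds: "\<And>x. x \<in> carrier_vec n \<Longrightarrow> x \<noteq> 0\<^sub>v n \<Longrightarrow>
      quad S x > 0 \<and> \<alpha> * quad S x \<le> quad T x \<and> quad T x < \<beta> * quad S x"
    and w: "w \<in> carrier_vec n" "w \<noteq> 0\<^sub>v n"
    and eig: "map_mat complex_of_real T *\<^sub>v w = \<mu> \<cdot>\<^sub>v (map_mat complex_of_real S *\<^sub>v w)"
  shows "\<mu> \<in> complex_of_real ` {\<alpha>..<\<beta>}"
proof -
  let ?a = "map_vec Re w" and ?b = "map_vec Im w"
  define t where "t = quad T ?a + quad T ?b"
  define s where "s = quad S ?a + quad S ?b"
  have ab: "?a \<in> carrier_vec n" "?b \<in> carrier_vec n" using w by auto
  have "of_real t = (\<Sum>i<n. cnj (w $ i) * (map_mat complex_of_real T *\<^sub>v w) $ i)"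
    unfolding t_def by (rule hermitian_form_real[OF T w(1), symmetric])
  also have "\<dots> = (\<Sum>i<n. \<mu> * (cnj (w $ i) * (map_mat complex_of_real S *\<^sub>v w) $ i))"
    unfolding eig using S by (auto intro!: sum.cong)
  also have "\<dots> = \<mu> * of_real s"
    unfolding s_def hermitian_form_real[OF S w(1), symmetric] by (rule sum_distrib_left[symmetric])
  finally have ts: "of_real t = \<mu> * of_real s" .
  have zero: "quad S (0\<^sub>v n) = 0" "quad T (0\<^sub>v n) = 0"
    using S T by (auto intro: quad_zero_vec)
  have "?a \<noteq> 0\<^sub>v n \<or> ?b \<noteq> 0\<^sub>v n"
  proof (rule ccontr)
    assume "\<not> ?thesis"
    then have "Re (w $ i) = 0 \<and> Im (w $ i) = 0" if "i < n" for i
      using that w by (metis carrier_vecD index_map_vec(1) index_zero_vec(1))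
    then have "w = 0\<^sub>v n" using w by (auto simp: complex_eq_iff)
    with w show False by simp
  qed
  then have "s > 0 \<and> \<alpha> * s \<le> t \<and> t < \<beta> * s"
    unfolding s_def t_def using bounds[OF ab(1)] bounds[OF ab(2)] zero
    by (cases "?a = 0\<^sub>v n"; cases "?b = 0\<^sub>v n") (auto simp: algebra_simps)
  then have "\<mu> = of_real (t / s)" "t / s \<in> {\<alpha>..<\<beta>}"
    using ts by (auto simp: field_simps)
  then show ?thesis by blast
qed

section \<open>The preconditioned saddle point matrix\<close>

lemma char_poly_block_upper_unit:
  fixes P :: "'a :: idom mat"
  assumes P: "P \<in> carrier_mat m m" and B: "B \<in> carrier_mat n m"
  shows "char_poly (four_block_mat (1\<^sub>m n) B (0\<^sub>m m n) P) = [:-1, 1:] ^ n * char_poly P"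
proof -
  have "char_poly (four_block_mat (1\<^sub>m n) B (0\<^sub>m m n) P) =
     det (four_block_mat (char_poly_matrix (1\<^sub>m n)) (map_mat (\<lambda>a. [:-a:]) B) (0\<^sub>m m n) (char_poly_matrix P))"
    unfolding char_poly_def
    by (rule arg_cong[of _ _ det], rule eq_matI, insert P B, auto simp: char_poly_matrix_def)
  also have "\<dots> = char_poly (1\<^sub>m n :: 'a mat) * char_poly P"
    unfolding char_poly_def
    by (rule det_four_block_mat_lower_left_zero) (use P B in auto)
  also have "char_poly (1\<^sub>m n :: 'a mat) = [:-1, 1:] ^ n"
  proof (subst char_poly_upper_triangular[of _ n])
    have "diag_mat (1\<^sub>m n :: 'a mat) = replicate n 1"
      by (intro nth_equalityI) (auto simp: diag_mat_def)
    then show "(\<Prod>a\<leftarrow>diag_mat (1\<^sub>m n :: 'a mat). [:- a, 1:]) = [:- 1, 1:] ^ n" by simp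
  qed auto
  finally show ?thesis .
qed

text \<open>Here \<open>L\<close> is the inverse of \<open>K\<close>. The scalar is kept arbitrary because both signs are needed:
  \<open>r = sqrt \<eta>\<close> gives the preconditioner, and \<open>r = - sqrt \<eta>\<close> the semidefinite matrix behind the
  lower bound \<open>1/2\<close>.\<close>

lemma factored_schur_expand:
  fixes K M :: "real mat"
  assumes K: "K \<in> carrier_mat n n" and M: "M \<in> carrier_mat n n" and L: "L \<in> carrier_mat n n"
    and "K * L = 1\<^sub>m n" "L * K = 1\<^sub>m n"
  shows "(M + r \<cdot>\<^sub>m K) * L * (M + r \<cdot>\<^sub>m K) = (M * L * M + r\<^sup>2 \<cdot>\<^sub>m K) + (2 * r) \<cdot>\<^sub>m M"
proof -
  have "(M + r \<cdot>\<^sub>m K) * L = M * L + r \<cdot>\<^sub>m 1\<^sub>m n"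
    using assms by (simp add: add_mult_distrib_mat[of _ n n _ _ n] mult_smult_assoc_mat[of K n n L n])
  moreover have "(M * L + r \<cdot>\<^sub>m 1\<^sub>m n) * (M + r \<cdot>\<^sub>m K)
      = (M * L * M + r \<cdot>\<^sub>m M) + r \<cdot>\<^sub>m (M * (L * K) + r \<cdot>\<^sub>m K)"
    using K M L by (simp add: mult_smult_distrib[of _ n n _ n] mult_smult_assoc_mat[of _ n n _ n] add_mult_distrib_mat[of _ n n _ _ n] mult_add_distrib_mat[of _ n n _ n])
  ultimately show ?thesis
    using assms by (intro eq_matI) (auto simp: power2_eq_square algebra_simps simp del: index_mult_mat(1))
qed


text \<open>The algebraic core. With \<open>L\<close> the inverse of \<open>K\<close>, \<open>T = M L M + \<eta> K\<close> is the exact Schur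
  complement (up to sign) and \<open>S\<close> the preconditioner replacing it. Block elimination turns
  \<open>B\<inverse> A\<close> into the upper triangular \<open>X\<close> with diagonal blocks \<open>1\<close> and
  \<open>S\<inverse> T\<close>, and \<open>S - T\<close> is positive definite while \<open>2 T - S\<close> is positive
  semidefinite.\<close>

lemma btdsc_spectrum:
  assumes \<eta>: "\<eta> > 0" and K: "spd n K" and M: "spd n M"
  shows "invertible_mat (B_btdsc \<eta> K M)"
    and "eigenvalue (preconditioned_mat \<eta> K M) k \<Longrightarrow> k \<in> complex_of_real ` {1/2..<1} \<union> {1}"
    and "Polynomial.order 1 (char_poly (preconditioned_mat \<eta> K M)) = n"
proof -
  define L where "L = mat_inv K"
  define S where "S = S_pre \<eta> K M"
  define T where "T = M * L * M + \<eta> \<cdot>\<^sub>m K"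
  note L = spd_mat_inv[OF K, folded L_def]
  have Kc: "K \<in> carrier_mat n n" "K\<^sup>T = K" and Mc: "M \<in> carrier_mat n n" "M\<^sup>T = M"
    and Lc: "L \<in> carrier_mat n n" "L\<^sup>T = L"
    using K M L(4) by (auto simp: spd_def)
  have Tc: "T \<in> carrier_mat n n" using Kc Mc Lc by (auto simp: T_def)
  have S_minus: "(M + r \<cdot>\<^sub>m K) * L * (M + r \<cdot>\<^sub>m K) = T + (2 * r) \<cdot>\<^sub>m M" if "r\<^sup>2 = \<eta>" for r
    using factored_schur_expand[OF Kc(1) Mc(1) L(1-3), of r] that by (simp add: T_def)
  have S_T: "S = T + (2 * sqrt \<eta>) \<cdot>\<^sub>m M"
    unfolding S_def S_pre_def L_def[symmetric] using \<eta> by (intro S_minus) simp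
  have Sc: "S \<in> carrier_mat n n" using Tc Mc by (simp add: S_T)
  have T_sym: "T\<^sup>T = T"
    using Kc Mc Lc by (simp add: T_def transpose_add[of _ n n] transpose_mult[of _ n n _ n] transpose_smult_mat
        assoc_mult_mat[of M n n L n M n])
  have S_sym: "S\<^sup>T = S"
    using Tc T_sym Mc by (simp add: S_T transpose_add[of _ n n] transpose_smult_mat)
  have bounds: "quad S x > 0 \<and> 1/2 * quad S x \<le> quad T x \<and> quad T x < 1 * quad S x"
    if x: "x \<in> carrier_vec n" "x \<noteq> 0\<^sub>v n" for x
  proof -
    have qM: "quad M x > 0" and qK: "quad K x > 0" using K M x by (auto simp: spd_def)
    have qS: "quad S x = quad T x + 2 * sqrt \<eta> * quad M x"
      using Tc Mc x by (simp add: S_T quad_add[of _ n] quad_smult[of _ n])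
    have "quad (M * L * M) x = quad L (M *\<^sub>v x)"
      by (rule quad_sandwich[OF Mc Lc(1) x(1)])
    then have "quad (M * L * M) x \<ge> 0"
      using spd_nonneg[OF L(4), of "M *\<^sub>v x"] Mc x by simp
    then have qT: "quad T x > 0"
      using \<eta> qK Kc Mc Lc x by (simp add: T_def quad_add[of _ n] quad_smult[of _ n] add_nonneg_pos)
    \<comment> \<open>\<open>2 T - S = T - 2 sqrt \<eta> M\<close> is the factored form with the opposite sign of the root.\<close>
    let ?D = "M + (- sqrt \<eta>) \<cdot>\<^sub>m K"
    have Dc: "?D \<in> carrier_mat n n" "?D\<^sup>T = ?D"
      using Kc Mc by (auto simp: transpose_add[of _ n n] transpose_smult_mat)
    have "0 \<le> quad L (?D *\<^sub>v x)"
      using spd_nonneg[OF L(4), of "?D *\<^sub>v x"] Dc x by simp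
    also have "\<dots> = quad (?D * L * ?D) x"
      by (rule quad_sandwich[OF Dc Lc(1) x(1), symmetric])
    also have "\<dots> = quad T x - 2 * sqrt \<eta> * quad M x"
      using \<eta> Tc Mc x by (subst S_minus) (auto simp: quad_add[of _ n] quad_smult[of _ n])
    finally show ?thesis using qS qT qM \<eta> by (simp add: add_pos_pos)
  qed
  then have S_spd: "spd n S" using Sc S_sym by (auto simp: spd_def)
  define R where "R = mat_inv S"
  note R = spd_mat_inv(1-3)[OF S_spd, folded R_def]
  define P where "P = R * T"
  define X where "X = four_block_mat (1\<^sub>m n) (L * M) (0\<^sub>m n n) P"
  have Pc: "P \<in> carrier_mat n n" using R Tc by (simp add: P_def)
  have SP: "S * P = T"
    using assoc_mult_mat[of S n n R n T n] Sc R Tc by (simp add: P_def)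
  have Xc: "X \<in> carrier_mat (n + n) (n + n)" using Pc by (simp add: X_def)
  have B: "B_btdsc \<eta> K M = four_block_mat K (0\<^sub>m n n) M (- S)"
    using Kc by (simp add: B_btdsc_def S_def)
  have Bc: "B_btdsc \<eta> K M \<in> carrier_mat (n + n) (n + n)" using Kc Sc by (simp add: B)
  have "det (B_btdsc \<eta> K M) = det K * det (- S)"
    unfolding B using Kc Mc Sc by (intro det_four_block_mat_upper_right_zero) auto
  then have detB: "det (B_btdsc \<eta> K M) \<noteq> 0"
    using spd_det[OF K] spd_det[OF S_spd] det_0_negate[OF Sc] by simp
  show "invertible_mat (B_btdsc \<eta> K M)"
    by (rule invertible_mat_det[OF Bc detB])
  have KLM: "K * (L * M) = M"
    using assoc_mult_mat[of K n n L n M n] Kc Lc Mc L by simp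
  have MLM: "M * (L * M) + - S * P = - (\<eta> \<cdot>\<^sub>m K)"
  proof -
    have "- S * P = - T" using Sc Pc SP by simp
    then show ?thesis
      using Kc Mc Lc by (simp add: T_def assoc_mult_mat[of M n n L n M n]) (intro eq_matI, auto)
  qed
  have BX: "B_btdsc \<eta> K M * X = A_mat \<eta> K M"
    unfolding B X_def A_mat_def
    by (subst mult_four_block_mat[of _ n n _ n _ n _ _ n _ n])
      (use Kc Mc Lc Sc Pc KLM MLM in auto)
  have "mat_inv (B_btdsc \<eta> K M) * A_mat \<eta> K M = X"
    using mat_inv_inverse[OF Bc detB] Bc Xc
      assoc_mult_mat[of "mat_inv (B_btdsc \<eta> K M)" "n + n" "n + n" "B_btdsc \<eta> K M" "n + n" X "n + n"]
    by (simp add: BX)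
  then have pre: "preconditioned_mat \<eta> K M = map_mat complex_of_real X"
    by (simp add: preconditioned_mat_def)
  let ?P = "map_mat complex_of_real P"
  have "preconditioned_mat \<eta> K M
      = four_block_mat (1\<^sub>m n) (map_mat complex_of_real (L * M)) (0\<^sub>m n n) ?P"
    unfolding pre X_def using Lc Mc Pc
    by (subst map_four_block_mat[of _ n n _ n _ n]) (auto simp: of_real_hom.mat_hom_one)
  then have cp: "char_poly (preconditioned_mat \<eta> K M) = [:-1, 1:] ^ n * char_poly ?P"
    using char_poly_block_upper_unit[of ?P n "map_mat complex_of_real (L * M)" n] Lc Mc Pc by simp
  have eigP: "\<mu> \<in> complex_of_real ` {1/2..<1}" if eig: "eigenvalue ?P \<mu>" for \<mu>
  proof -
    obtain w where w: "w \<in> carrier_vec n" "w \<noteq> 0\<^sub>v n" "?P *\<^sub>v w = \<mu> \<cdot>\<^sub>v w"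
      using eig Pc unfolding eigenvalue_def eigenvector_def by auto
    let ?S = "map_mat complex_of_real S"
    have "map_mat complex_of_real T *\<^sub>v w = ?S *\<^sub>v (?P *\<^sub>v w)"
      unfolding SP[symmetric] using Sc Pc w(1) by (simp add: of_real_hom.mat_hom_mult[of S n n P n] assoc_mult_mat_vec[of ?S n n ?P n])
    also have "\<dots> = \<mu> \<cdot>\<^sub>v (?S *\<^sub>v w)"
      unfolding w(3) using Sc w(1) by (intro mult_mat_vec[of _ n n]) auto
    finally show ?thesis
      using generalized_eigenvalue_rayleigh[OF Tc T_sym Sc S_sym bounds w(1,2)] by blast
  qed
  have root: "eigenvalue ?P \<mu> \<longleftrightarrow> poly (char_poly ?P) \<mu> = 0" for \<mu>
    using eigenvalue_root_char_poly[of ?P n] Pc by simp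
  show "k \<in> complex_of_real ` {1/2..<1} \<union> {1}" if "eigenvalue (preconditioned_mat \<eta> K M) k"
  proof -
    have "poly (char_poly (preconditioned_mat \<eta> K M)) k = 0"
      using that eigenvalue_root_char_poly[of "preconditioned_mat \<eta> K M" "n + n"] Xc by (simp add: pre)
    then have "k = 1 \<or> eigenvalue ?P k"
      by (auto simp: cp root poly_power)
    then show ?thesis using eigP by auto
  qed
  \<comment> \<open>No eigenvalue of \<open>S\<inverse> T\<close> equals 1, so the multiplicity of 1 comes from the unit block alone.\<close>
  have "poly (char_poly ?P) 1 \<noteq> 0"
  proof
    assume "poly (char_poly ?P) 1 = 0"
    then obtain t where "1 = complex_of_real t" "t < 1" using eigP[of 1] root[of 1] by auto
    then show False by (metis of_real_eq_1_iff less_irrefl)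
  qed
  moreover from this have "char_poly ?P \<noteq> 0" by auto
  ultimately show "Polynomial.order 1 (char_poly (preconditioned_mat \<eta> K M)) = n"
    unfolding cp by (subst order_mult) (auto simp: order_0I order_power_n_n)
qed

section \<open>Gram forms and almost everywhere vanishing functions\<close>

text \<open>A Gram matrix of square integrable functions represents the squared norm of their linear
  combinations. Mass and stiffness matrix are the cases of real valued functions and of
  gradients.\<close>

lemma gram_form_integral:
  fixes f :: "nat \<Rightarrow> 'a \<Rightarrow> 'b::real_inner" and c :: "nat \<Rightarrow> real"
  assumes "\<And>i j. i < n \<Longrightarrow> j < n \<Longrightarrow> set_integrable M A (\<lambda>z. inner (f i z) (f j z))"
  defines "F \<equiv> \<lambda>z. inner (\<Sum>i<n. c i *\<^sub>R f i z) (\<Sum>j<n. c j *\<^sub>R f j z)"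
  shows "set_integrable M A F"
    and "(\<Sum>i<n. \<Sum>j<n. (LINT z:A|M. inner (f i z) (f j z)) * (c i * c j)) = (LINT z:A|M. F z)"
proof -
  have F: "indicator A z *\<^sub>R F z
      = (\<Sum>i<n. \<Sum>j<n. (indicator A z *\<^sub>R inner (f i z) (f j z)) * (c i * c j))" for z
    unfolding F_def
    by (auto simp: inner_sum_left inner_sum_right sum_distrib_left indicator_def inner_commute mult_ac
        intro!: sum.cong)
  have int: "integrable M (\<lambda>z. (indicator A z *\<^sub>R inner (f i z) (f j z)) * (c i * c j))"
    if "i < n" "j < n" for i j
    using assms(1)[OF that] unfolding set_integrable_def by (rule integrable_mult_left)
  show "set_integrable M A F"
    unfolding set_integrable_def F using int by (intro Bochner_Integration.integrable_sum) auto
  have "(LINT z:A|M. F z)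
      = (\<Sum>i<n. LINT z|M. (\<Sum>j<n. (indicator A z *\<^sub>R inner (f i z) (f j z)) * (c i * c j)))"
    unfolding set_lebesgue_integral_def F
    by (intro Bochner_Integration.integral_sum Bochner_Integration.integrable_sum int) auto
  also have "\<dots> = (\<Sum>i<n. \<Sum>j<n. LINT z|M. (indicator A z *\<^sub>R inner (f i z) (f j z)) * (c i * c j))"
    by (intro sum.cong refl Bochner_Integration.integral_sum int) auto
  also have "\<dots> = (\<Sum>i<n. \<Sum>j<n. (LINT z:A|M. inner (f i z) (f j z)) * (c i * c j))"
    unfolding set_lebesgue_integral_def by simp
  finally show "(\<Sum>i<n. \<Sum>j<n. (LINT z:A|M. inner (f i z) (f j z)) * (c i * c j)) = (LINT z:A|M. F z)"
    by simp
qed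

lemma set_integral_inner_self_eq_0:
  fixes g :: "'a \<Rightarrow> 'b::real_inner"
  assumes "set_integrable M A (\<lambda>z. inner (g z) (g z))"
    and "(LINT z:A|M. inner (g z) (g z)) = 0"
  shows "AE z in M. z \<in> A \<longrightarrow> g z = 0"
proof -
  have "AE z in M. indicator A z *\<^sub>R inner (g z) (g z) = 0"
    using assms unfolding set_integrable_def set_lebesgue_integral_def
    by (subst (asm) integral_nonneg_eq_0_iff_AE) auto
  then show ?thesis by eventually_elim (auto simp: indicator_def)
qed

lemma set_integral_inner_self_nonneg:
  fixes g :: "'a \<Rightarrow> 'b::real_inner"
  shows "0 \<le> (LINT z:A|M. inner (g z) (g z))"
  unfolding set_lebesgue_integral_def by (rule Bochner_Integration.integral_nonneg) auto

text \<open>Nonempty open sets have positive measure, so an almost everywhere property holds somewhere in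
  each of them.\<close>

lemma AE_lebesgue_open_witness:
  fixes U :: "'a::euclidean_space set"
  assumes ae: "AE z in lebesgue. z \<in> A \<longrightarrow> P z" and U: "open U" "U \<noteq> {}" "U \<subseteq> A"
  obtains z where "z \<in> U" "P z"
proof (rule ccontr)
  assume "\<not> thesis"
  then have "\<forall>z\<in>U. \<not> P z" using that by blast
  then have "AE z in lebesgue. z \<notin> U"
    using ae U by (auto elim!: eventually_mono)
  then have "negligible U"
    using U by (subst negligible_iff_null_sets, subst AE_iff_null_sets) auto
  then show False using open_not_negligible U by blast
qed

lemma grad_affine:
  assumes "open U" "z \<in> U" and f: "\<And>y. y \<in> U \<Longrightarrow> f y = inner g y + c"
  shows "grad f z = g"
proof -
  have "((\<lambda>y. inner g y + c) has_derivative (\<lambda>h. inner h g)) (at z)"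
    by (auto intro!: derivative_eq_intros simp: inner_commute)
  then have D: "GDERIV f z :> g"
    unfolding gderiv_def
    by (rule has_derivative_transform_within_open[OF _ assms(1,2)]) (simp add: f)
  have "D = g" if "GDERIV f z :> D" for D
  proof -
    have "(\<lambda>h. inner h D) = (\<lambda>h. inner h g)"
      using that D unfolding gderiv_def by (rule has_derivative_unique)
    then show ?thesis by (metis vector_eq_rdot inner_commute vector_eq_ldot)
  qed
  with D show ?thesis unfolding grad_def by blast
qed

lemma Omega_facts:
  "open Omega" "interior (closure Omega) = Omega" "compact (closure Omega)"
  "connected (closure Omega)" "Omega \<in> sets lebesgue"
proof -
  show o: "open Omega" unfolding Omega_def by (intro open_Times) auto
  have c: "closure Omega = {0..1} \<times> {0..1}" unfolding Omega_def by (simp add: closure_Times)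
  show "interior (closure Omega) = Omega"
    unfolding c by (simp add: interior_Times Omega_def)
  show "compact (closure Omega)" unfolding c by (intro compact_Times) auto
  show "connected (closure Omega)" unfolding c by (intro connected_Times) auto
  show "Omega \<in> sets lebesgue" using o by auto
qed

lemma continuous_set_integrable_Omega:
  assumes "continuous_on (closure Omega) (f :: point \<Rightarrow> real)"
  shows "set_integrable lebesgue Omega f"
proof -
  have "integrable lborel (\<lambda>x. indicator (closure Omega) x *\<^sub>R f x)"
    using borel_integrable_compact[OF Omega_facts(3) assms] .
  then have "set_integrable lebesgue (closure Omega) f"
    unfolding set_integrable_def
    by (subst integrable_completion) (auto intro: borel_measurable_integrable)
  then show ?thesis
    by (rule set_integrable_subset) (auto simp: Omega_facts(5) closure_subset)
qed

lemma continuous_AE_zero_Omega: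
  assumes cont: "continuous_on (closure Omega) (f :: point \<Rightarrow> real)"
    and ae: "AE z in lebesgue. z \<in> Omega \<longrightarrow> f z = 0" and z: "z \<in> closure Omega"
  shows "f z = 0"
proof (rule continuous_constant_on_closure[OF cont _ z])
  fix y assume y: "y \<in> Omega"
  show "f y = 0"
  proof (rule ccontr)
    assume "f y \<noteq> 0"
    let ?U = "Omega \<inter> f -` (- {0})"
    have "open ?U"
      using continuous_on_subset[OF cont closure_subset]
      by (rule continuous_open_preimage) (auto simp: Omega_facts(1))
    moreover have "?U \<noteq> {}" using y \<open>f y \<noteq> 0\<close> by auto
    ultimately obtain w where "w \<in> ?U" "f w = 0"
      using AE_lebesgue_open_witness[OF ae, of ?U] by blast
    then show False by auto
  qed
qed

section \<open>Definiteness of the finite element matrices\<close>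

locale nodal_basis =
  fixes \<T> :: "point set set" and \<phi> :: "point \<Rightarrow> point \<Rightarrow> real" and n :: nat and nd :: "nat \<Rightarrow> point"
  assumes triangulates: "triangulates_Omega \<T>"
    and enum: "bij_betw nd {..<n} (nodes \<T>)"
    and nodal: "is_nodal_basis \<T> \<phi>"
begin

definition fe_function :: "real Matrix.vec \<Rightarrow> point \<Rightarrow> real" where
  "fe_function x z = (\<Sum>i<n. x $ i * \<phi> (nd i) z)"

lemma triangle_facts:
  assumes "T \<in> \<T>"
  shows "convex T" "closed T" "bounded T" "T \<subseteq> closure Omega" "interior T \<noteq> {}" "interior T \<subseteq> Omega"
proof -
  have s: "2 simplex T" using assms triangulates unfolding triangulates_Omega_def by blast
  show c: "convex T" using s by (simp add: simplex_def) (metis convex_convex_hull)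
  show "closed T" "bounded T"
    using simplex_imp_polytope[OF s] polytope_imp_closed polytope_imp_bounded by auto
  show sub: "T \<subseteq> closure Omega" using assms triangulates unfolding triangulates_Omega_def by blast
  have "aff_dim T = DIM(point)" using aff_dim_simplex[OF s] by simp
  then have "affine hull T = UNIV" "T \<noteq> {}" by (auto simp flip: aff_dim_eq_full)
  then show "interior T \<noteq> {}" 
    using rel_interior_interior[of T] rel_interior_eq_empty[OF c] by auto
  show "interior T \<subseteq> Omega" using interior_mono[OF sub] Omega_facts(2) by auto
qed

lemma finite_triangles: "finite \<T>"
  using triangulates unfolding triangulates_Omega_def triangulation_def by blast

lemma nodes_closure: "i < n \<Longrightarrow> nd i \<in> nodes \<T> \<and> nd i \<in> closure Omega"
proof -
  assume "i < n"
  then have "nd i \<in> nodes \<T>" using enum by (auto simp: bij_betw_def)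
  moreover from this obtain T where "T \<in> \<T>" "nd i \<in> T"
    unfolding nodes_def extreme_point_of_def by auto
  ultimately show ?thesis using triangle_facts(4) by blast
qed

lemma basis_continuous: "i < n \<Longrightarrow> continuous_on (closure Omega) (\<phi> (nd i))"
  using nodal nodes_closure unfolding is_nodal_basis_def fe_space_def by blast

lemma fe_function_continuous: "continuous_on (closure Omega) (fe_function x)"
  unfolding fe_function_def by (intro continuous_intros basis_continuous) auto

lemma fe_function_node:
  assumes "i < n"
  shows "fe_function x (nd i) = x $ i"
proof -
  have "\<phi> (nd j) (nd i) = (if j = i then 1 else 0)" if "j < n" for j
  proof -
    have "nd j = nd i \<longleftrightarrow> j = i"
      using enum that assms by (auto simp: bij_betw_def inj_on_def)
    then show ?thesis
      using nodal nodes_closure that assms unfolding is_nodal_basis_def by auto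
  qed
  then have "fe_function x (nd i) = (\<Sum>j<n. if j = i then x $ j else 0)"
    unfolding fe_function_def by (intro sum.cong) auto
  then show ?thesis using assms by simp
qed

lemma basis_affine_pieces:
  obtains g c where "\<And>T i z. T \<in> \<T> \<Longrightarrow> i < n \<Longrightarrow> z \<in> T \<Longrightarrow> \<phi> (nd i) z = inner (g T i) z + c T i"
proof -
  have "\<forall>T i. \<exists>gc. T \<in> \<T> \<and> i < n \<longrightarrow> (\<forall>z\<in>T. \<phi> (nd i) z = inner (fst gc) z + snd gc)"
    using nodal nodes_closure unfolding is_nodal_basis_def fe_space_def by fastforce
  then obtain gc where "\<forall>T i. T \<in> \<T> \<and> i < n \<longrightarrow> (\<forall>z\<in>T. \<phi> (nd i) z = inner (fst (gc T i)) z + snd (gc T i))"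
    by metis
  then show thesis using that[of "\<lambda>T i. fst (gc T i)" "\<lambda>T i. snd (gc T i)"] by blast
qed

text \<open>What the open triangles leave uncovered lies on finitely many boundaries of convex sets.\<close>

lemma interiors_cover_ae: "negligible (Omega - (\<Union>T\<in>\<T>. interior T))"
proof (rule negligible_subset)
  show "negligible (\<Union>T\<in>\<T>. frontier T)"
    using finite_triangles triangle_facts(1) negligible_convex_frontier by (intro negligible_Union) auto
  have cover: "Omega \<subseteq> \<Union>\<T>"
    using triangulates closure_subset[of Omega] unfolding triangulates_Omega_def by simp
  show "Omega - (\<Union>T\<in>\<T>. interior T) \<subseteq> (\<Union>T\<in>\<T>. frontier T)"
  proof
    fix z assume z: "z \<in> Omega - (\<Union>T\<in>\<T>. interior T)"
    then obtain T where T: "T \<in> \<T>" "z \<in> T" using cover by blast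
    then have "z \<in> closure T - interior T" using z closure_subset[of T] by blast
    then show "z \<in> (\<Union>T\<in>\<T>. frontier T)" using T(1) unfolding frontier_def by blast
  qed
qed

text \<open>Since \<^const>\<open>grad\<close> has an unspecified value wherever a function is not differentiable,
  integrability of products of gradients rests on their values inside the triangles only.\<close>

lemma piecewise_constant_integrable:
  fixes F :: "point \<Rightarrow> real"
  assumes "\<And>T z. T \<in> \<T> \<Longrightarrow> z \<in> interior T \<Longrightarrow> F z = a T"
  shows "set_integrable lebesgue Omega F"
proof -
  let ?U = "\<Union>T\<in>\<T>. interior T"
  have "set_integrable lebesgue (interior T) F" if T: "T \<in> \<T>" for T
  proof -
    have "integrable lebesgue (\<lambda>z. indicator (interior T) z *\<^sub>R a T)"
      using lmeasurable_interior[OF triangle_facts(3)[OF T]]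
      by (intro integrable_scaleR_left) (auto simp: fmeasurable_def intro!: integrable_real_indicator)
    then have "set_integrable lebesgue (interior T) (\<lambda>z. a T)" by (simp add: set_integrable_def)
    then show ?thesis
      using assms[OF T] by (subst set_integrable_cong[OF refl refl]) auto
  qed
  moreover have U_sets: "?U \<in> sets lebesgue" by (simp add: open_UN lborelD)
  ultimately have "set_integrable lebesgue ?U F"
    using finite_triangles by (intro set_integrable_UN) auto
  moreover have "set_integrable lebesgue (Omega - ?U) F"
    using interiors_cover_ae by (rule absolutely_integrable_negligible)
  ultimately have "set_integrable lebesgue (?U \<union> (Omega - ?U)) F"
    using interiors_cover_ae
    by (intro set_integrable_Un) (auto simp: negligible_iff_null_sets intro: U_sets)
  moreover have "?U \<union> (Omega - ?U) = Omega" using triangle_facts(6) by blast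
  ultimately show ?thesis by simp
qed

lemma mass_form:
  "x \<in> carrier_vec n \<Longrightarrow>
    quad (mass_mat n nd \<phi>) x = (LINT z:Omega|lebesgue. fe_function x z * fe_function x z)"
  "set_integrable lebesgue Omega (\<lambda>z. fe_function x z * fe_function x z)"
proof -
  have int: "set_integrable lebesgue Omega (\<lambda>z. inner (\<phi> (nd i) z) (\<phi> (nd j) z))" if "i < n" "j < n" for i j
    using that by (intro continuous_set_integrable_Omega continuous_intros basis_continuous)
  show "set_integrable lebesgue Omega (\<lambda>z. fe_function x z * fe_function x z)"
    using gram_form_integral(1)[of n lebesgue Omega "\<lambda>i. \<phi> (nd i)" "\<lambda>i. x $ i", OF int]
    by (simp add: fe_function_def)
  show "quad (mass_mat n nd \<phi>) x = (LINT z:Omega|lebesgue. fe_function x z * fe_function x z)"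
    if "x \<in> carrier_vec n"
    using that gram_form_integral(2)[of n lebesgue Omega "\<lambda>i. \<phi> (nd i)" "\<lambda>i. x $ i", OF int]
    by (simp add: quad_sum[of _ n] fe_function_def mass_mat_def)
qed

lemma fe_function_eq_0_imp:
  assumes "\<And>z. z \<in> closure Omega \<Longrightarrow> fe_function x z = 0" "x \<in> carrier_vec n"
  shows "x = 0\<^sub>v n"
proof (rule eq_vecI)
  fix i assume "i < dim_vec (0\<^sub>v n :: real Matrix.vec)"
  then have "i < n" by simp
  then show "x $ i = (0\<^sub>v n :: real Matrix.vec) $ i"
    using assms(1)[of "nd i"] nodes_closure[of i] fe_function_node[of i x] by simp
qed (use assms in auto)

text \<open>A continuous function with vanishing \<open>L\<^sup>2\<close> norm vanishes on the whole closed square, in particular at the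
  nodes, where it takes the values \<open>x\<close>.\<close>

lemma mass_form_definite:
  assumes "(LINT z:Omega|lebesgue. fe_function x z * fe_function x z) = 0" "x \<in> carrier_vec n"
  shows "x = 0\<^sub>v n"
proof (rule fe_function_eq_0_imp[OF _ assms(2)])
  have "AE z in lebesgue. z \<in> Omega \<longrightarrow> fe_function x z = 0"
    using set_integral_inner_self_eq_0[of lebesgue Omega "fe_function x"] mass_form(2) assms by simp
  then show "fe_function x z = 0" if "z \<in> closure Omega" for z
    using continuous_AE_zero_Omega[OF fe_function_continuous _ that] by blast
qed

lemma mass_spd: "spd n (mass_mat n nd \<phi>)"
proof -
  have "quad (mass_mat n nd \<phi>) x > 0" if x: "x \<in> carrier_vec n" "x \<noteq> 0\<^sub>v n" for x
    using mass_form(1)[OF x(1)] mass_form_definite[of x] x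
      set_integral_inner_self_nonneg[of lebesgue Omega "fe_function x"] by force
  then show ?thesis
    by (auto simp: spd_def mass_mat_def mult.commute)
qed

lemma mean_form: "(\<Sum>i<n. mean_vec n nd \<phi> $ i * x $ i) = (LINT z:Omega|lebesgue. fe_function x z)"
proof -
  have int: "integrable lebesgue (\<lambda>z. indicator Omega z *\<^sub>R \<phi> (nd i) z * x $ i)" if "i < n" for i
    using continuous_set_integrable_Omega[OF basis_continuous[OF that]]
    unfolding set_integrable_def by (rule integrable_mult_left)
  have "(LINT z:Omega|lebesgue. fe_function x z) = (LINT z|lebesgue. (\<Sum>i<n. indicator Omega z *\<^sub>R \<phi> (nd i) z * x $ i))"
    unfolding set_lebesgue_integral_def fe_function_def
    by (auto simp: sum_distrib_left mult_ac intro!: Bochner_Integration.integral_cong sum.cong)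
  also have "\<dots> = (\<Sum>i<n. LINT z|lebesgue. indicator Omega z *\<^sub>R \<phi> (nd i) z * x $ i)"
    by (rule Bochner_Integration.integral_sum) (use int in auto)
  finally show ?thesis
    by (simp add: mean_vec_def set_lebesgue_integral_def)
qed

lemma Kbar_index:
  assumes "i < n" "j < n"
  shows "Kbar_mat n nd \<phi> $$ (i, j)
    = stiffness_mat n nd \<phi> $$ (i, j) + mean_vec n nd \<phi> $ i * mean_vec n nd \<phi> $ j"
  using assms unfolding Kbar_mat_def
  by (simp add: stiffness_mat_def mean_vec_def scalar_prod_def mat_of_cols_def)

lemma Kbar_carrier: "Kbar_mat n nd \<phi> \<in> carrier_mat n n"
  unfolding Kbar_mat_def stiffness_mat_def by (intro carrier_matI) simp_all

lemma Kbar_form: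
  assumes "x \<in> carrier_vec n"
  shows "quad (Kbar_mat n nd \<phi>) x
    = (\<Sum>i<n. \<Sum>j<n. stiffness_mat n nd \<phi> $$ (i, j) * (x $ i * x $ j)) + (LINT z:Omega|lebesgue. fe_function x z)\<^sup>2"
  unfolding quad_sum[OF Kbar_carrier assms] mean_form[symmetric] power2_eq_square sum_product
    sum.distrib[symmetric]
  by (intro sum.cong refl) (simp add: Kbar_index algebra_simps)

text \<open>The form is the Dirichlet energy plus the squared mean. If both vanish, the finite element
  function is constant on each triangle, hence takes finitely many values; by continuity on a
  connected set it is one constant \<open>a\<close>, and the vanishing mean forces it to be zero.\<close>

lemma Kbar_form_definite:
  assumes x: "x \<in> carrier_vec n" "x \<noteq> 0\<^sub>v n"
  shows "quad (Kbar_mat n nd \<phi>) x > 0"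
proof -
  obtain g c where gc: "\<And>T i z. T \<in> \<T> \<Longrightarrow> i < n \<Longrightarrow> z \<in> T \<Longrightarrow> \<phi> (nd i) z = inner (g T i) z + c T i"
    using basis_affine_pieces by blast
  have grad: "grad (\<phi> (nd i)) z = g T i" if "T \<in> \<T>" "i < n" "z \<in> interior T" for T i z
    using that gc[OF that(1,2)] interior_subset
    by (intro grad_affine[of "interior T" _ _ _ "c T i"]) blast+
  let ?G = "\<lambda>z. \<Sum>i<n. x $ i *\<^sub>R grad (\<phi> (nd i)) z"
  have int: "set_integrable lebesgue Omega (\<lambda>z. inner (grad (\<phi> (nd i)) z) (grad (\<phi> (nd j)) z))"
    if "i < n" "j < n" for i j
    by (rule piecewise_constant_integrable[of _ "\<lambda>T. inner (g T i) (g T j)"]) (simp add: grad that)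
  have intG: "set_integrable lebesgue Omega (\<lambda>z. inner (?G z) (?G z))"
    by (rule gram_form_integral(1)) (rule int)
  have "(\<Sum>i<n. \<Sum>j<n. stiffness_mat n nd \<phi> $$ (i, j) * (x $ i * x $ j)) = (LINT z:Omega|lebesgue. inner (?G z) (?G z))"
    using gram_form_integral(2)[of n lebesgue Omega "\<lambda>i. grad (\<phi> (nd i))" "\<lambda>i. x $ i", OF int]
    by (simp add: stiffness_mat_def)
  note form = Kbar_form[OF x(1), unfolded this]
  have nonneg: "0 \<le> (LINT z:Omega|lebesgue. inner (?G z) (?G z))"
    by (rule set_integral_inner_self_nonneg)
  show ?thesis
  proof (rule ccontr)
    assume "\<not> ?thesis"
    then have "(LINT z:Omega|lebesgue. inner (?G z) (?G z)) + (LINT z:Omega|lebesgue. fe_function x z)\<^sup>2 \<le> 0"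
      unfolding form by simp
    then have G0: "(LINT z:Omega|lebesgue. inner (?G z) (?G z)) = 0" and m0: "(LINT z:Omega|lebesgue. fe_function x z) = 0"
      using nonneg zero_le_power2[of "LINT z:Omega|lebesgue. fe_function x z"] by (smt (verit) power2_less_eq_zero_iff)+
    have ae: "AE z in lebesgue. z \<in> Omega \<longrightarrow> ?G z = 0"
      using set_integral_inner_self_eq_0[OF intG G0] .
    have slope0: "(\<Sum>i<n. x $ i *\<^sub>R g T i) = 0" if T: "T \<in> \<T>" for T
    proof -
      obtain z where "z \<in> interior T" "?G z = 0"
        using AE_lebesgue_open_witness[OF ae open_interior triangle_facts(5,6)[OF T]] by blast
      then show ?thesis using grad[OF T] by simp
    qed
    have piece: "fe_function x z = (\<Sum>i<n. x $ i * c T i)" if "T \<in> \<T>" "z \<in> T" for T z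
    proof -
      have "fe_function x z = inner (\<Sum>i<n. x $ i *\<^sub>R g T i) z + (\<Sum>i<n. x $ i * c T i)"
        unfolding fe_function_def using gc that by (simp add: inner_sum_left sum.distrib[symmetric] algebra_simps)
      then show ?thesis using slope0[OF that(1)] by simp
    qed
    have "closure Omega = \<Union>\<T>" using triangulates unfolding triangulates_Omega_def by simp
    then have "fe_function x ` closure Omega \<subseteq> (\<lambda>T. \<Sum>i<n. x $ i * c T i) ` \<T>"
      using piece by auto
    then have "finite (fe_function x ` closure Omega)"
      using finite_triangles finite_surj by blast
    then have "fe_function x constant_on closure Omega"
      using continuous_finite_range_constant[OF Omega_facts(4) fe_function_continuous] by blast
    then obtain a where a: "\<And>z. z \<in> closure Omega \<Longrightarrow> fe_function x z = a"
      unfolding constant_on_def by blast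
    \<comment> \<open>A constant function \<open>a\<close> has squared norm \<open>a\<close> times its mean, which is zero here, so
      definiteness of the mass form applies.\<close>
    have "(LINT z:Omega|lebesgue. fe_function x z * fe_function x z) = (LINT z:Omega|lebesgue. a * fe_function x z)"
      by (rule set_lebesgue_integral_cong) (use a closure_subset Omega_facts(5) in auto)
    also have "\<dots> = 0" using m0 by simp
    finally show False using mass_form_definite x by blast
  qed
qed

lemma Kbar_spd: "spd n (Kbar_mat n nd \<phi>)"
proof -
  have "(Kbar_mat n nd \<phi>)\<^sup>T = Kbar_mat n nd \<phi>"
  proof (rule eq_matI)
    fix i j assume "i < dim_row (Kbar_mat n nd \<phi>)" "j < dim_col (Kbar_mat n nd \<phi>)"
    then have ij: "i < n" "j < n" using Kbar_carrier by auto
    then show "(Kbar_mat n nd \<phi>)\<^sup>T $$ (i, j) = Kbar_mat n nd \<phi> $$ (i, j)"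
      using Kbar_carrier Kbar_index[OF ij] Kbar_index[OF ij(2,1)]
      by (simp add: stiffness_mat_def inner_commute mult.commute)
  qed (use Kbar_carrier in auto)
  then show ?thesis
    using Kbar_carrier Kbar_form_definite by (auto simp: spd_def)
qed

end

section \<open>Spectrum for the finite element matrices\<close>

theorem theorem5p3:
  fixes \<eta> :: real and \<T> :: "point set set" and \<phi> :: "point \<Rightarrow> point \<Rightarrow> real"
    and n :: nat and nd :: "nat \<Rightarrow> point" and M Kb :: "real mat"
  assumes "\<eta> > 0"
    and "triangulates_Omega \<T>"
    and "bij_betw nd {..<n} (nodes \<T>)"
    and "is_nodal_basis \<T> \<phi>"
    and "M = mass_mat n nd \<phi>"
    and "Kb = Kbar_mat n nd \<phi>"
  shows "invertible_mat Kb \<and> invertible_mat (B_btdsc \<eta> Kb M) \<and>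
    (\<forall>k. eigenvalue (preconditioned_mat \<eta> Kb M) k \<longrightarrow>
       k \<in> complex_of_real ` {1/2..<1} \<union> {1}) \<and>
    Polynomial.order 1 (char_poly (preconditioned_mat \<eta> Kb M)) = n"
proof -
  interpret nodal_basis \<T> \<phi> n nd
    using assms(2-4) by unfold_locales
  show ?thesis
    using btdsc_spectrum[OF assms(1) Kbar_spd mass_spd] spd_det[OF Kbar_spd]
      invertible_mat_det[OF Kbar_carrier]
    unfolding assms(5,6) by blast
qed

end
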